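(* Let $K_1$ and $K_2$ be finite abstract simplicial complexes and let $K_1\vee_kK_2$ be a combinatorial $k$-wedge sum of them, obtained by identifying a $k$-face of $K_1$ with a $k$-face of $K_2$. Then for all $i,k$ with $0\le k<i$, the multiset of eigenvalues of $\Delta_i^{up}(K_1\vee_kK_2)$ and the multiset union (multiplicities added) of the eigenvalues of $\Delta_i^{up}(K_1)$ and of $\Delta_i^{up}(K_2)$ differ at most in the multiplicity of the eigenvalue zero.
   Context: Given $k$-faces $F_1=\{v_0,\dots,v_k\}$ of $K_1$ and $F_2=\{u_0,\dots,u_k\}$ of $K_2$, the combinatorial $k$-wedge sum $K_1\vee_kK_2$ is the simplicial complex obtained from the disjoint union of $K_1$ and $K_2$ by identifying $v_j$ with $u_j$ for $j=0,\dots,k$ (so $F_1$ is identified with $F_2$); its faces are exactly the images of faces of $K_1$ and of $K_2$. For a finite abstract simplicial complex $K$ (closed under inclusion, containing the empty face), $S_i(K)$ is the set of $i$-faces and $C^i(K,\mathbb{R})$ is the space of real functions on oriented $i$-faces that change sign when the orientation is reversed. The coboundary $\delta_i:C^i\to C^{i+1}$ is $(\delta_i f)([v_0,\dots,v_{i+1}])=\sum_{j}(-1)^j f([v_0,\dots,\hat v_j,\dots,v_{i+1}])$. A positive weight function $w$ on faces defines inner products $(f,g)_{C^i}=\sum_{F\in S_i(K)}w(F)f([F])g([F])$, with adjoint $\delta_i^*$. The degree of an $i$-face is $\deg F=\sum_{\bar F\in S_{i+1}(K),\,F\subset\bar F}w(\bar F)$. The normalized combinatorial Laplacian is $\Delta_i^{up}(K)=\delta_i^*\delta_i$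 on $C^i(K,\mathbb{R})$ for the weight function with $w(F)=1$ for every facet (inclusion-maximal face) and $w(F)=\deg F$ for every other face. *)

theory Defs
  imports Complex_Main "HOL-Combinatorics.Permutations" "HOL-Library.Function_Algebras"
    "HOL-Library.Multiset"
begin

definition simplicial_complex :: "'a set set \<Rightarrow> bool" where
  "simplicial_complex K \<longleftrightarrow>
     finite K \<and> (\<forall>F\<in>K. finite F) \<and> {} \<in> K \<and> (\<forall>F\<in>K. \<forall>G. G \<subseteq> F \<longrightarrow> G \<in> K)"

definition faces :: "'a set set \<Rightarrow> nat \<Rightarrow> 'a set set" where
  "faces K i = {F \<in> K. finite F \<and> card F = i + 1}"

definition facet :: "'a set set \<Rightarrow> 'a set \<Rightarrow> bool" where
  "facet K F \<longleftrightarrow> F \<in> K \<and> \<not> (\<exists>G\<in>K. F \<subset> G)"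

text \<open>
  An oriented face \<open>[v\<^sub>0, \<dots>, v\<^sub>i]\<close> is presented by a list of its distinct vertices, two lists
  presenting the same oriented face iff they differ by an even permutation.  A function on
  oriented faces that changes sign with the orientation is thus a function on lists that
  transforms by the sign of a permutation.  Cochains vanish on all lists that do not
  order an \<open>i\<close>-face, so that they are determined by their values on the faces.
\<close>

definition cochains :: "'a set set \<Rightarrow> nat \<Rightarrow> ('a list \<Rightarrow> real) set" where
  "cochains K i = {f.
     (\<forall>xs. \<not> (distinct xs \<and> set xs \<in> faces K i) \<longrightarrow> f xs = 0) \<and>
     (\<forall>xs p. p permutes {..<length xs} \<longrightarrow> f (permute_list p xs) = of_int (sign p) * f xs)}"

definition coboundary :: "'a set set \<Rightarrow> nat \<Rightarrow> ('a list \<Rightarrow> real) \<Rightarrow> 'a list \<Rightarrow> real" where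
  "coboundary K i f xs =
     (if distinct xs \<and> set xs \<in> faces K (i + 1)
      then \<Sum>j\<le>i + 1. (- 1) ^ j * f (take j xs @ drop (Suc j) xs) else 0)"

text \<open>
  An arbitrary reference orientation \<open>[F]\<close>; the inner product below does not depend on it.
\<close>

definition orientation :: "'a set \<Rightarrow> 'a list" where
  "orientation F = (SOME xs. distinct xs \<and> set xs = F)"

definition cochain_inner ::
  "('a set \<Rightarrow> real) \<Rightarrow> 'a set set \<Rightarrow> nat \<Rightarrow> ('a list \<Rightarrow> real) \<Rightarrow> ('a list \<Rightarrow> real) \<Rightarrow> real" where
  "cochain_inner w K i f g = (\<Sum>F\<in>faces K i. w F * f (orientation F) * g (orientation F))"

text \<open>
  The adjoint of the coboundary; it exists and is unique on a finite complex when \<open>w\<close> is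
  positive, as the inner product is then positive definite on the cochains.
\<close>

definition coboundary_adjoint ::
  "('a set \<Rightarrow> real) \<Rightarrow> 'a set set \<Rightarrow> nat \<Rightarrow> ('a list \<Rightarrow> real) \<Rightarrow> 'a list \<Rightarrow> real" where
  "coboundary_adjoint w K i g =
     (THE h. h \<in> cochains K i \<and>
        (\<forall>f\<in>cochains K i.
           cochain_inner w K (i + 1) (coboundary K i f) g = cochain_inner w K i f h))"

definition up_laplacian ::
  "('a set \<Rightarrow> real) \<Rightarrow> 'a set set \<Rightarrow> nat \<Rightarrow> ('a list \<Rightarrow> real) \<Rightarrow> 'a list \<Rightarrow> real" where
  "up_laplacian w K i f = coboundary_adjoint w K i (coboundary K i f)"

text \<open>
  The weight function with value 1 on facets and the degree on every other face, by downward
  recursion.  The guard \<open>finite K \<and> F \<in> K\<close> only serves to make the recursion terminate.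
\<close>

function normalized_weight :: "'a set set \<Rightarrow> 'a set \<Rightarrow> real" where
  "normalized_weight K F =
     (if finite K \<and> F \<in> K then
        (if facet K F then 1
         else \<Sum>G\<in>{G \<in> K. F \<subset> G \<and> card G = card F + 1}. normalized_weight K G)
      else 0)"
  by auto
termination
proof (relation "measure (\<lambda>(K, F). card {G \<in> K. F \<subset> G})")
  fix K :: "'a set set" and F G
  assume K: "finite K \<and> F \<in> K" and G: "G \<in> {G \<in> K. F \<subset> G \<and> card G = card F + 1}"
  have "{H \<in> K. G \<subset> H} \<subset> {H \<in> K. F \<subset> H}"
    using G by auto
  with K show "((K, G), (K, F)) \<in> measure (\<lambda>(K, F). card {G \<in> K. F \<subset> G})"
    by (auto intro!: psubset_card_mono)
qed simp

declare normalized_weight.simps [simp del]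

definition degree :: "('a set \<Rightarrow> real) \<Rightarrow> 'a set set \<Rightarrow> 'a set \<Rightarrow> real" where
  "degree w K F = (\<Sum>G\<in>{G \<in> K. F \<subset> G \<and> card G = card F + 1}. w G)"

lemma normalized_weight_eq:
  assumes "finite K" "F \<in> K"
  shows "normalized_weight K F =
    (if facet K F then 1 else degree (normalized_weight K) K F)"
  using assms by (simp add: normalized_weight.simps [of K F] degree_def)

definition normalized_up_laplacian ::
  "'a set set \<Rightarrow> nat \<Rightarrow> ('a list \<Rightarrow> real) \<Rightarrow> 'a list \<Rightarrow> real" where
  "normalized_up_laplacian K = up_laplacian (normalized_weight K) K"

definition fun_scale :: "real \<Rightarrow> ('b \<Rightarrow> real) \<Rightarrow> 'b \<Rightarrow> real" where
  "fun_scale c f = (\<lambda>x. c * f x)"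

interpretation real_fun: vector_space fun_scale
  by unfold_locales (auto simp: fun_scale_def algebra_simps)

definition eigenspace ::
  "('b \<Rightarrow> real) set \<Rightarrow> (('b \<Rightarrow> real) \<Rightarrow> 'b \<Rightarrow> real) \<Rightarrow> real \<Rightarrow> ('b \<Rightarrow> real) set" where
  "eigenspace V T a = {f \<in> V. T f = fun_scale a f}"

text \<open>
  Each eigenvalue of \<open>T\<close> on \<open>V\<close> is counted with the dimension of its eigenspace, which for a
  self-adjoint operator is also the algebraic multiplicity.  The sum is meaningful only for
  finitely many eigenvalues, as is the case for a linear \<open>T\<close> on a finite-dimensional \<open>V\<close>.
\<close>

definition eigenvalues ::
  "('b \<Rightarrow> real) set \<Rightarrow> (('b \<Rightarrow> real) \<Rightarrow> 'b \<Rightarrow> real) \<Rightarrow> real multiset" where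
  "eigenvalues V T =
     (\<Sum>a\<in>{a. \<exists>f\<in>eigenspace V T a. f \<noteq> 0}. replicate_mset (real_fun.dim (eigenspace V T a)) a)"

definition up_spectrum :: "'a set set \<Rightarrow> nat \<Rightarrow> real multiset" where
  "up_spectrum K i = eigenvalues (cochains K i) (normalized_up_laplacian K i)"

text \<open>
  The vertices of the wedge sum are the classes of the disjoint union of the vertices under the
  equivalence relation generated by \<open>v j \<sim> u j\<close> for \<open>j \<le> k\<close>.
\<close>

definition wedge_class ::
  "nat \<Rightarrow> (nat \<Rightarrow> 'a) \<Rightarrow> (nat \<Rightarrow> 'b) \<Rightarrow> 'a + 'b \<Rightarrow> ('a + 'b) set" where
  "wedge_class k v u x = (let r = {(Inl (v j), Inr (u j)) | j. j \<le> k} in (r \<union> r\<inverse>)\<^sup>* `` {x})"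

definition wedge_sum ::
  "nat \<Rightarrow> (nat \<Rightarrow> 'a) \<Rightarrow> (nat \<Rightarrow> 'b) \<Rightarrow> 'a set set \<Rightarrow> 'b set set \<Rightarrow> ('a + 'b) set set set" where
  "wedge_sum k v u K\<^sub>1 K\<^sub>2 =
     (\<lambda>F. wedge_class k v u ` Inl ` F) ` K\<^sub>1 \<union> (\<lambda>F. wedge_class k v u ` Inr ` F) ` K\<^sub>2"

end

theory Submission
  imports Defs
begin

text \<open>
  A face common to both summands of the wedge sum has at most \<open>k + 1 \<le> i\<close> vertices.  Hence the
  \<open>i\<close>-faces and the \<open>(i + 1)\<close>-faces of the wedge sum are split disjointly between the summands, and
  a face of dimension at least \<open>i\<close> has all its cofaces in its own summand, so that it keeps its
  weight.  Cochains, their inner products and the quadratic forms \<open>(\<delta>f, \<delta>g)\<close> in dimension \<open>i\<close>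
  therefore decompose orthogonally.  Since \<open>f\<close> is an eigenvector for \<open>a\<close> iff
  \<open>(\<delta>g, \<delta>f) = a (g, f)\<close> for all cochains \<open>g\<close>, every eigenspace of the wedge sum, including the
  kernel, is the direct sum of the eigenspaces of the summands.
\<close>

section \<open>Alternating functions on lists\<close>

text \<open>The sign rule is separated from the support condition of \<open>cochains\<close>, so
  that it can be used in every degree without naming a complex, in particular for
  coboundaries.\<close>

definition alternating :: "('a list \<Rightarrow> real) \<Rightarrow> bool" where
  "alternating f \<longleftrightarrow>
     (\<forall>xs p. p permutes {..<length xs} \<longrightarrow> f (permute_list p xs) = of_int (sign p) * f xs)"

lemma cochains_iff:
  "f \<in> cochains K i \<longleftrightarrow>
     (\<forall>xs. \<not> (distinct xs \<and> set xs \<in> faces K i) \<longrightarrow> f xs = 0) \<and> alternating f"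
  by (simp add: cochains_def alternating_def)

lemma permute_list_transpose:
  "permute_list (transpose (length us) (Suc (length us + length ys))) (us @ x # ys @ y # zs) =
     us @ y # ys @ x # zs" (is "?l = ?r")
proof -
  let ?m = "length us" and ?n = "Suc (length us + length ys)"
  have perm: "transpose ?m ?n permutes {..<length (us @ x # ys @ y # zs)}"
    by (rule permutes_swap_id) auto
  show ?thesis
  proof (rule nth_equalityI)
    fix j assume "j < length ?l"
    then have "?l ! j = (us @ x # ys @ y # zs) ! transpose ?m ?n j"
      using perm by (simp add: permute_list_nth)
    also have "\<dots> = ?r ! j"
    proof -
      consider "j = ?m" | "j = ?n" | "j \<noteq> ?m" "j \<noteq> ?n" by blast
      then show ?thesis
      proof cases
        case 1
        have "(us @ x # ys @ y # zs) ! ?n = y"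
          using nth_append_length[of "us @ x # ys" y zs] by simp
        with 1 show ?thesis by simp
      next
        case 2
        have "(us @ y # ys @ x # zs) ! ?n = x"
          using nth_append_length[of "us @ y # ys" x zs] by simp
        with 2 show ?thesis by simp
      next
        case 3
        then show ?thesis by (auto simp: nth_append nth_Cons' transpose_def)
      qed
    qed
    finally show "?l ! j = ?r ! j" .
  qed simp
qed

lemma alternatingD:
  assumes "alternating f"
  shows "f (us @ y # ys @ x # zs) = - f (us @ x # ys @ y # zs)"
proof -
  have "transpose (length us) (Suc (length us + length ys)) permutes
      {..<length (us @ x # ys @ y # zs)}"
    by (rule permutes_swap_id) auto
  with assms have "f (permute_list (transpose (length us) (Suc (length us + length ys)))
      (us @ x # ys @ y # zs)) = - f (us @ x # ys @ y # zs)"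
    unfolding alternating_def by (simp add: sign_swap_id)
  then show ?thesis by (simp only: permute_list_transpose)
qed

lemma split_list_at:
  assumes "n < length xs"
  shows "\<exists>us x vs. xs = us @ x # vs \<and> length us = n"
  using id_take_nth_drop[OF assms] assms
  by (intro exI[of _ "take n xs"] exI[of _ "xs ! n"] exI[of _ "drop (Suc n) xs"]) simp

text \<open>Adjacent transpositions generate the symmetric group: they yield the swaps of distant
  entries, and these yield all permutations by composition.\<close>

lemma alternating_if_adjacent:
  assumes adj: "\<And>us x y zs. f (us @ y # x # zs) = - f (us @ x # y # zs)"
  shows "alternating f"
proof -
  \<comment> \<open>Induction on the block between the two entries. Each step makes three sign
    changes: \<open>y\<close> moves past \<open>c\<close>, the entries are swapped over the shorter
    block, and \<open>x\<close> moves back past \<open>c\<close>.\<close>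
  have far: "f (us @ y # ys @ x # zs) = - f (us @ x # ys @ y # zs)" for us x y ys zs
  proof (induction ys arbitrary: us)
    case (Cons c ys)
    have "f (us @ y # (c # ys) @ x # zs) = - f ((us @ [c]) @ y # ys @ x # zs)"
      using adj[of us y c "ys @ x # zs"] by simp
    also have "\<dots> = f ((us @ [c]) @ x # ys @ y # zs)"
      by (simp only: Cons.IH minus_minus)
    also have "\<dots> = - f (us @ x # (c # ys) @ y # zs)"
      using adj[of us c x "ys @ y # zs"] by simp
    finally show ?case .
  qed (simp only: append_Nil, rule adj)
  have less: "f (permute_list (transpose a b) xs) = - f xs" if "a < b" "b < length xs" for a b xs
  proof -
    obtain us x vs where xs: "xs = us @ x # vs" and a: "a = length us"
      using split_list_at[of a xs] \<open>a < b\<close> \<open>b < length xs\<close> by (metis less_trans)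
    obtain ys y zs where vs: "vs = ys @ y # zs" and b: "length ys = b - Suc a"
    proof -
      have "b - Suc a < length vs" using \<open>a < b\<close> \<open>b < length xs\<close> xs a by simp
      from split_list_at[OF this] show ?thesis using that by blast
    qed
    have "b = Suc (length us + length ys)" using \<open>a < b\<close> a b by simp
    then show ?thesis
      using far[of us y ys x zs] by (simp only: xs vs a permute_list_transpose)
  qed
  have any: "f (permute_list (transpose a b) xs) = - f xs"
    if "a \<noteq> b" "a < length xs" "b < length xs" for a b xs
  proof (cases "a < b")
    case True
    then show ?thesis using less that by blast
  next
    case False
    then show ?thesis using less[of b a xs] that by (simp add: transpose_commute)
  qed
  \<comment> \<open>The list is quantified inside the claim, since the induction hypothesis for
    \<open>p\<close> is applied to a list that has already been transposed.\<close>
  have "\<forall>xs. length xs = n \<longrightarrow> f (permute_list p xs) = of_int (sign p) * f xs"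
    if "p permutes {..<n}" for p n
    using that finite_lessThan
  proof (induction rule: permutes_induct)
    case (swap a b p)
    have "permutation p" using swap.hyps by (auto simp: permutation_permutes)
    then have s: "sign (transpose a b \<circ> p) = - sign p"
      using swap.hyps by (simp add: sign_compose permutation_swap_id sign_swap_id)
    show ?case
    proof (intro allI impI)
      fix xs :: "'a list" assume n: "length xs = n"
      have "f (permute_list (transpose a b \<circ> p) xs)
          = f (permute_list p (permute_list (transpose a b) xs))"
        using swap.hyps n by (simp add: permute_list_compose)
      also have "\<dots> = of_int (sign p) * f (permute_list (transpose a b) xs)"
        using swap.IH n by simp
      also have "\<dots> = of_int (sign p) * (- f xs)"
        using swap.hyps n by (subst any) auto
      finally show "f (permute_list (transpose a b \<circ> p) xs)
          = of_int (sign (transpose a b \<circ> p)) * f xs"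
        by (simp add: s)
    qed
  qed simp
  then show ?thesis unfolding alternating_def by blast
qed

lemma faces_card: "set xs \<in> faces K j \<Longrightarrow> distinct xs \<Longrightarrow> length xs = j + 1"
  by (auto simp: faces_def distinct_card)

text \<open>It suffices to swap two neighbours and to match the term of index \<open>j\<close> with
  the term of the transposed index. If the deleted entry is one of the two, the shortened lists
  agree and the sign comes from the index shifting by one; otherwise they differ by the swap and the
  sign comes from \<open>f\<close>.\<close>

lemma alternating_coboundary:
  assumes f: "alternating f"
  shows "alternating (coboundary K i f)"
proof (rule alternating_if_adjacent)
  fix us zs :: "'a list" and x y
  let ?xs = "us @ x # y # zs" and ?ys = "us @ y # x # zs"
  let ?m = "length us"
  let ?t = "transpose ?m (Suc ?m)"
  have same: "distinct ?ys \<longleftrightarrow> distinct ?xs" "set ?ys = set ?xs" by auto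
  show "coboundary K i f ?ys = - coboundary K i f ?xs"
  proof (cases "distinct ?xs \<and> set ?xs \<in> faces K (i + 1)")
    case True
    then have len: "length ?xs = i + 2" using faces_card[of ?xs K "i + 1"] by simp
    have adj: "f (us @ y # x # zs) = - f (us @ x # y # zs)" for us zs
      using alternatingD[OF f, of us y "[]" x zs] by simp
    have swapped: "(- 1) ^ ?t j * f (take (?t j) ?ys @ drop (Suc (?t j)) ?ys)
        = - ((- 1) ^ j * f (take j ?xs @ drop (Suc j) ?xs))" for j
    proof -
      consider "j < ?m" | "j = ?m" | "j = Suc ?m" | r where "j = Suc (Suc (?m + r))"
        by (metis add_Suc_shift less_iff_Suc_add less_antisym linorder_neqE_nat not_less_eq)
      then show ?thesis
      proof cases
        case 1
        then have "?t j = j" by (simp add: transpose_def)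
        moreover have "take j (us @ a # b # zs) @ drop (Suc j) (us @ a # b # zs)
            = (take j us @ drop (Suc j) us) @ a # b # zs" for a b
          using 1 by simp
        ultimately show ?thesis by (simp only: adj mult_minus_right)
      next
        case 4
        then have "?t j = j" by (simp add: transpose_def)
        moreover have "take j (us @ a # b # zs) @ drop (Suc j) (us @ a # b # zs)
            = us @ a # b # (take r zs @ drop (Suc r) zs)" for a b
          using 4 by (simp add: numeral_3_eq_3)
        ultimately show ?thesis by (simp only: adj mult_minus_right)
      qed simp_all
    qed
    \<comment> \<open>The list has \<open>i + 2\<close> entries, so both swapped positions lie in
      the summation range and the sum can be reindexed.\<close>
    have "?t permutes {..i + 1}" using len by (intro permutes_swap_id) auto
    then have "(\<Sum>j\<le>i + 1. (- 1) ^ j * f (take j ?ys @ drop (Suc j) ?ys))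
        = (\<Sum>j\<le>i + 1. (- 1) ^ ?t j * f (take (?t j) ?ys @ drop (Suc (?t j)) ?ys))"
      by (subst sum.permute) (auto simp: o_def)
    with True same show ?thesis
      by (simp only: coboundary_def swapped sum_negf if_True simp_thms)
  next
    case False
    then have "coboundary K i f ?xs = 0" "coboundary K i f ?ys = 0"
      using same by (simp_all only: coboundary_def if_False)
    then show ?thesis by simp
  qed
qed

section \<open>Reference orientations and elementary cochains\<close>

lemma orientation:
  assumes "finite F"
  shows "distinct (orientation F)" "set (orientation F) = F"
proof -
  have "\<exists>xs. distinct xs \<and> set xs = F" using finite_distinct_list[OF assms] by blast
  then have "distinct (orientation F) \<and> set (orientation F) = F"
    unfolding orientation_def by (rule someI_ex)
  then show "distinct (orientation F)" "set (orientation F) = F" by auto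
qed

lemma reordering_exists:
  assumes "distinct xs"
  obtains p where "p permutes {..<length (orientation (set xs))}"
    "permute_list p (orientation (set xs)) = xs"
proof -
  have "mset xs = mset (orientation (set xs))"
    using assms by (subst set_eq_iff_mset_eq_distinct[symmetric]) (auto simp: orientation)
  then show ?thesis using that mset_eq_permutation by metis
qed

text \<open>Distinct entries determine their positions. This is what makes the definite description
  in \<open>basis_cochain\<close> well defined.\<close>

lemma reordering_unique:
  assumes "distinct xs" "p permutes {..<length xs}" "q permutes {..<length xs}"
    "permute_list p xs = permute_list q xs"
  shows "p = q"
proof
  fix j
  show "p j = q j"
  proof (cases "j < length xs")
    case True
    then have "xs ! p j = xs ! q j"
      using assms by (metis permute_list_nth)
    moreover have "p j < length xs" "q j < length xs"
      using True assms permutes_in_image by fastforce+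
    ultimately show ?thesis using assms(1) by (simp add: nth_eq_iff_index_eq)
  qed (use assms in \<open>auto simp: permutes_def\<close>)
qed

text \<open>The elementary cochain dual to the oriented face \<open>[F]\<close>. For
  \<open>F\<close> ranging over the \<open>i\<close>-faces these form a basis of the
  \<open>i\<close>-cochains.\<close>

definition basis_cochain :: "'a set \<Rightarrow> 'a list \<Rightarrow> real" where
  "basis_cochain F xs =
     (if distinct xs \<and> set xs = F
      then of_int (sign (THE p. p permutes {..<length (orientation F)} \<and>
        permute_list p (orientation F) = xs)) else 0)"

lemma basis_cochain_permute:
  assumes "finite F" "p permutes {..<length (orientation F)}"
  shows "basis_cochain F (permute_list p (orientation F)) = of_int (sign p)"
proof -
  have "(THE q. q permutes {..<length (orientation F)} \<and>
      permute_list q (orientation F) = permute_list p (orientation F)) = p"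
    using assms reordering_unique[OF orientation(1)] by (intro the_equality) auto
  with assms show ?thesis
    by (simp add: basis_cochain_def orientation)
qed

lemma basis_cochain_orientation:
  assumes "finite F" "finite G"
  shows "basis_cochain F (orientation G) = (if F = G then 1 else 0)"
proof (cases "F = G")
  case True
  then show ?thesis using basis_cochain_permute[OF assms(1), of id] by (simp add: permutes_id)
next
  case False
  then show ?thesis using assms by (simp add: basis_cochain_def orientation)
qed

lemma alternating_basis_cochain: "alternating (basis_cochain F)"
  unfolding alternating_def
proof (intro allI impI)
  fix xs :: "'a list" and p assume p: "p permutes {..<length xs}"
  show "basis_cochain F (permute_list p xs) = of_int (sign p) * basis_cochain F xs"
  proof (cases "distinct xs \<and> set xs = F")
    case True
    then obtain q where q: "q permutes {..<length (orientation F)}"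
      "permute_list q (orientation F) = xs"
      using reordering_exists by metis
    have fin: "finite F" using True by auto
    have len: "length (orientation F) = length xs" using q by auto
    \<comment> \<open>As \<open>q\<close> carries the reference orientation to \<open>xs\<close>,
      \<open>q \<circ> p\<close> carries it to the permuted list, and signs multiply.\<close>
    have qp: "q \<circ> p permutes {..<length (orientation F)}"
      using p q len by (simp add: permutes_compose)
    have "permute_list p xs = permute_list (q \<circ> p) (orientation F)"
      using p q len by (simp add: permute_list_compose)
    moreover have "sign (q \<circ> p) = sign q * sign p"
      using p q by (intro sign_compose) (auto simp: permutation_permutes)
    ultimately show ?thesis
      using basis_cochain_permute[OF fin qp] basis_cochain_permute[OF fin q(1)] q(2) by simp
  qed (use p in \<open>auto simp: basis_cochain_def\<close>)
qed

lemma basis_cochain_in: "F \<in> faces K i \<Longrightarrow> basis_cochain F \<in> cochains K i"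
  by (auto simp: cochains_iff alternating_basis_cochain) (auto simp: basis_cochain_def)

lemma alternating_eq_basis_cochain:
  assumes "alternating f" "distinct xs"
  shows "f xs = f (orientation (set xs)) * basis_cochain (set xs) xs"
proof -
  obtain p where p: "p permutes {..<length (orientation (set xs))}"
    "permute_list p (orientation (set xs)) = xs"
    using reordering_exists[OF assms(2)] .
  then have "basis_cochain (set xs) xs = of_int (sign p)"
    using basis_cochain_permute[of "set xs" p] by simp
  moreover have "f xs = of_int (sign p) * f (orientation (set xs))"
    using assms(1) p unfolding alternating_def by metis
  ultimately show ?thesis by simp
qed

text \<open>Both factors acquire the same sign, whose square is one. A product of two alternating
  functions is thus a function of the face alone, which is why the inner product does not depend on
  the reference orientations.\<close>

lemma alternating_mult_orientation:
  assumes "alternating f" "alternating g" "distinct xs"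
  shows "f xs * g xs = f (orientation (set xs)) * g (orientation (set xs))"
proof -
  obtain p where p: "p permutes {..<length (orientation (set xs))}"
    "permute_list p (orientation (set xs)) = xs"
    using reordering_exists[OF assms(3)] .
  then have "f xs = of_int (sign p) * f (orientation (set xs))"
    "g xs = of_int (sign p) * g (orientation (set xs))"
    using assms(1,2) unfolding alternating_def by metis+
  then show ?thesis by (cases p rule: sign_cases) simp_all
qed

section \<open>The adjoint of the coboundary and eigenspaces\<close>

lemma finite_faces: "finite K \<Longrightarrow> finite (faces K i)"
  by (simp add: faces_def)

lemma faces_finite: "F \<in> faces K i \<Longrightarrow> finite F"
  by (simp add: faces_def)

lemma coboundary_add:
  "coboundary K i (f + g) = coboundary K i f + coboundary K i g"
  by (rule ext) (simp add: coboundary_def ring_distribs sum.distrib)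

lemma coboundary_fun_scale:
  "coboundary K i (fun_scale c f) = fun_scale c (coboundary K i f)"
  by (rule ext) (simp add: coboundary_def fun_scale_def sum_distrib_left algebra_simps)

lemma coboundary_zero: "coboundary K i 0 = 0"
  by (rule ext) (simp add: coboundary_def)

lemma cochain_inner_sum_right:
  "cochain_inner w K i f (\<Sum>b\<in>B. fun_scale (c b) (h b)) = (\<Sum>b\<in>B. c b * cochain_inner w K i f (h b))"
  by (induction B rule: infinite_finite_induct)
    (simp_all add: cochain_inner_def fun_scale_def ring_distribs sum.distrib sum_distrib_left mult.left_commute)

lemma cochain_inner_commute: "cochain_inner w K i f g = cochain_inner w K i g f"
  by (simp add: cochain_inner_def algebra_simps)

lemma cochain_inner_add_right:
  "cochain_inner w K i f (g + h) = cochain_inner w K i f g + cochain_inner w K i f h"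
  by (simp add: cochain_inner_def ring_distribs sum.distrib)

lemma cochain_inner_fun_scale_right:
  "cochain_inner w K i f (fun_scale c g) = c * cochain_inner w K i f g"
  by (simp add: cochain_inner_def fun_scale_def sum_distrib_left mult.left_commute)

lemma cochain_inner_zero_left [simp]: "cochain_inner w K i 0 g = 0"
  and cochain_inner_zero_right [simp]: "cochain_inner w K i f 0 = 0"
  by (simp_all add: cochain_inner_def)

lemma subspace_cochains: "real_fun.subspace (cochains K i)"
  unfolding real_fun.subspace_def
  by (auto simp: cochains_def fun_scale_def algebra_simps)

text \<open>At a list \<open>xs\<close> only the face \<open>set xs\<close> contributes, and there
  the value at the reference orientation determines \<open>f\<close>.\<close>

lemma cochain_expansion:
  assumes "finite K" "f \<in> cochains K i"
  shows "f = (\<Sum>F\<in>faces K i. fun_scale (f (orientation F)) (basis_cochain F))"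
proof
  fix xs
  have "(\<Sum>F\<in>faces K i. fun_scale (f (orientation F)) (basis_cochain F)) xs
      = (\<Sum>F\<in>faces K i. f (orientation F) * basis_cochain F xs)"
    using finite_faces[OF assms(1)] by (induction rule: finite_induct) (simp_all add: fun_scale_def)
  also have "\<dots> = (\<Sum>F\<in>faces K i. if F = set xs then f xs else 0)"
  proof (rule sum.cong[OF refl])
    fix F assume "F \<in> faces K i"
    show "f (orientation F) * basis_cochain F xs = (if F = set xs then f xs else 0)"
    proof (cases "distinct xs \<and> F = set xs")
      case True
      then show ?thesis
        using alternating_eq_basis_cochain[of f xs] assms(2) by (simp add: cochains_iff)
    next
      case False
      then show ?thesis using assms(2) by (auto simp: basis_cochain_def cochains_iff)
    qed
  qed
  also have "\<dots> = f xs"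
    using assms finite_faces[OF assms(1), of i] by (auto simp: cochains_iff)
  finally show "f xs = (\<Sum>F\<in>faces K i. fun_scale (f (orientation F)) (basis_cochain F)) xs"
    by simp
qed

lemma cochains_subset_span:
  assumes "finite K"
  shows "cochains K i \<subseteq> real_fun.span (basis_cochain ` faces K i)"
proof
  fix f assume "f \<in> cochains K i"
  then have "f = (\<Sum>F\<in>faces K i. fun_scale (f (orientation F)) (basis_cochain F))"
    by (rule cochain_expansion[OF assms])
  also have "\<dots> \<in> real_fun.span (basis_cochain ` faces K i)"
    by (intro real_fun.span_sum real_fun.span_scale real_fun.span_base) auto
  finally show "f \<in> real_fun.span (basis_cochain ` faces K i)" .
qed

lemma coboundary_sum_fun_scale:
  "coboundary K i (\<Sum>b\<in>B. fun_scale (c b) (h b)) = (\<Sum>b\<in>B. fun_scale (c b) (coboundary K i (h b)))"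
  by (induction B rule: infinite_finite_induct)
    (simp_all only: sum.infinite sum.empty sum.insert coboundary_add coboundary_fun_scale
      coboundary_zero not_False_eq_True)

lemma cochain_inner_basis_cochain:
  assumes "finite K" "F \<in> faces K i"
  shows "cochain_inner w K i (basis_cochain F) h = w F * h (orientation F)"
proof -
  have "cochain_inner w K i (basis_cochain F) h
      = (\<Sum>G\<in>faces K i. if G = F then w F * h (orientation F) else 0)"
    unfolding cochain_inner_def using assms(2)
    by (intro sum.cong) (auto simp: basis_cochain_orientation faces_finite)
  then show ?thesis using assms finite_faces[of K i] by simp
qed

locale weighted_complex =
  fixes K :: "'a set set" and w :: "'a set \<Rightarrow> real"
  assumes finite_K: "finite K" and weight_pos: "F \<in> K \<Longrightarrow> w F > 0"
begin

lemma faces_weight_pos: "F \<in> faces K i \<Longrightarrow> w F > 0"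
  by (simp add: faces_def weight_pos)

text \<open>Pairing with an elementary cochain reads off the value on its face times the weight, and
  the positive weight cancels.\<close>

lemma cochain_eqI:
  assumes h: "h \<in> cochains K i" "h' \<in> cochains K i"
    and eq: "\<And>f. f \<in> cochains K i \<Longrightarrow> cochain_inner w K i f h = cochain_inner w K i f h'"
  shows "h = h'"
proof -
  have "h (orientation F) = h' (orientation F)" if F: "F \<in> faces K i" for F
    using eq[OF basis_cochain_in[OF F]] faces_weight_pos[OF F]
    by (simp add: cochain_inner_basis_cochain[OF finite_K F])
  then have "(\<Sum>F\<in>faces K i. fun_scale (h (orientation F)) (basis_cochain F)) =
      (\<Sum>F\<in>faces K i. fun_scale (h' (orientation F)) (basis_cochain F))"
    by (intro sum.cong) auto
  then show ?thesis
    using cochain_expansion[OF finite_K] h by metis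
qed

text \<open>Gives meaning to the definite description of the adjoint. Here \<open>g\<close> may be
  any function on lists: it enters only through the linear functional sending \<open>f\<close> to
  the pairing of its coboundary with \<open>g\<close>, and exactly one cochain represents this
  functional.\<close>

lemma coboundary_adjoint:
  "coboundary_adjoint w K i g \<in> cochains K i"
  "f \<in> cochains K i \<Longrightarrow>
    cochain_inner w K (i + 1) (coboundary K i f) g = cochain_inner w K i f (coboundary_adjoint w K i g)"
proof -
  define c where "c F = cochain_inner w K (i + 1) (coboundary K i (basis_cochain F)) g" for F
  \<comment> \<open>The coefficients are forced by testing the adjunction on the basis cochains.\<close>
  define h where "h = (\<Sum>F\<in>faces K i. fun_scale (c F / w F) (basis_cochain F))"
  have h: "h \<in> cochains K i"
    unfolding h_def
    by (intro real_fun.subspace_sum subspace_cochains real_fun.subspace_scale basis_cochain_in)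
  have adj: "cochain_inner w K (i + 1) (coboundary K i f) g = cochain_inner w K i f h"
    if f: "f \<in> cochains K i" for f
  proof -
    have "cochain_inner w K (i + 1) (coboundary K i f) g
        = cochain_inner w K (i + 1) g (\<Sum>F\<in>faces K i.
            fun_scale (f (orientation F)) (coboundary K i (basis_cochain F)))"
      using cochain_expansion[OF finite_K f] coboundary_sum_fun_scale cochain_inner_commute by metis
    also have "\<dots> = (\<Sum>F\<in>faces K i. f (orientation F) * c F)"
      by (simp only: cochain_inner_sum_right c_def cochain_inner_commute[of _ _ _ g])
    also have "\<dots> = (\<Sum>F\<in>faces K i. c F / w F * cochain_inner w K i (basis_cochain F) f)"
      using faces_weight_pos[of _ i]
      by (intro sum.cong) (simp_all add: cochain_inner_basis_cochain[OF finite_K] less_imp_neq[THEN not_sym])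
    also have "\<dots> = cochain_inner w K i f h"
      by (simp only: h_def cochain_inner_sum_right cochain_inner_commute[of _ _ _ f])
    finally show ?thesis .
  qed
  have "coboundary_adjoint w K i g = h"
    unfolding coboundary_adjoint_def
  proof (rule the_equality)
    fix h' assume "h' \<in> cochains K i \<and> (\<forall>f\<in>cochains K i.
        cochain_inner w K (i + 1) (coboundary K i f) g = cochain_inner w K i f h')"
    then show "h' = h" using h adj by (intro cochain_eqI) auto
  qed (use h adj in auto)
  then show "coboundary_adjoint w K i g \<in> cochains K i"
    "f \<in> cochains K i \<Longrightarrow>
      cochain_inner w K (i + 1) (coboundary K i f) g = cochain_inner w K i f (coboundary_adjoint w K i g)"
    using h adj by auto
qed

text \<open>The weak form of the eigenvalue equation, from the adjunction and nondegeneracy. From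
  here on the adjoint disappears, and only two bilinear forms have to be compared between
  complexes.\<close>

lemma eigenspace_iff:
  "f \<in> eigenspace (cochains K i) (up_laplacian w K i) a \<longleftrightarrow> f \<in> cochains K i \<and>
     (\<forall>g\<in>cochains K i. cochain_inner w K (i + 1) (coboundary K i g) (coboundary K i f)
        = a * cochain_inner w K i g f)"
proof -
  have "up_laplacian w K i f = fun_scale a f \<longleftrightarrow>
      (\<forall>g\<in>cochains K i. cochain_inner w K (i + 1) (coboundary K i g) (coboundary K i f)
        = a * cochain_inner w K i g f)" if f: "f \<in> cochains K i"
  proof -
    have "fun_scale a f \<in> cochains K i"
      using f by (rule real_fun.subspace_scale[OF subspace_cochains])
    then have "up_laplacian w K i f = fun_scale a f \<longleftrightarrow>
        (\<forall>g\<in>cochains K i. cochain_inner w K i g (up_laplacian w K i f)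
          = cochain_inner w K i g (fun_scale a f))"
      using cochain_eqI[of "up_laplacian w K i f" i "fun_scale a f"] coboundary_adjoint(1)
      by (auto simp: up_laplacian_def)
    then show ?thesis
      by (simp add: up_laplacian_def coboundary_adjoint(2)[symmetric, simplified]
          cochain_inner_fun_scale_right)
  qed
  then show ?thesis by (auto simp: eigenspace_def)
qed

lemma subspace_eigenspace:
  "real_fun.subspace (eigenspace (cochains K i) (up_laplacian w K i) a)"
proof (rule real_fun.subspaceI)
  show "0 \<in> eigenspace (cochains K i) (up_laplacian w K i) a"
    using real_fun.subspace_0[OF subspace_cochains[of K i]] by (simp only: eigenspace_iff coboundary_zero) simp
next
  fix f g
  assume "f \<in> eigenspace (cochains K i) (up_laplacian w K i) a"
    "g \<in> eigenspace (cochains K i) (up_laplacian w K i) a"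
  then show "f + g \<in> eigenspace (cochains K i) (up_laplacian w K i) a"
    using real_fun.subspace_add[OF subspace_cochains[of K i]]
    by (simp add: eigenspace_iff coboundary_add cochain_inner_add_right distrib_left del: plus_fun_apply)
next
  fix c f
  assume "f \<in> eigenspace (cochains K i) (up_laplacian w K i) a"
  then show "fun_scale c f \<in> eigenspace (cochains K i) (up_laplacian w K i) a"
    using real_fun.subspace_scale[OF subspace_cochains[of K i]]
    by (simp add: eigenspace_iff coboundary_fun_scale cochain_inner_fun_scale_right mult.left_commute)
qed

text \<open>Both forms are symmetric: testing \<open>f\<close> against \<open>g\<close> produces the
  factor \<open>a\<close>, testing \<open>g\<close> against \<open>f\<close> produces
  \<open>b\<close>.\<close>

lemma eigenspaces_orthogonal:
  assumes "f \<in> eigenspace (cochains K i) (up_laplacian w K i) a"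
    "g \<in> eigenspace (cochains K i) (up_laplacian w K i) b" "a \<noteq> b"
  shows "cochain_inner w K i f g = 0"
proof -
  have "a * cochain_inner w K i g f = b * cochain_inner w K i f g"
    using assms(1,2) cochain_inner_commute unfolding eigenspace_iff by metis
  with assms(3) show ?thesis by (simp add: cochain_inner_commute[of _ _ _ g])
qed

lemma cochain_inner_self_pos:
  assumes "f \<in> cochains K i" "f \<noteq> 0"
  shows "cochain_inner w K i f f > 0"
proof -
  have "\<exists>F\<in>faces K i. f (orientation F) \<noteq> 0"
  proof (rule ccontr)
    assume "\<not> ?thesis"
    then have "(\<Sum>F\<in>faces K i. fun_scale (f (orientation F)) (basis_cochain F)) = 0"
      by (intro sum.neutral) (auto simp: fun_scale_def fun_eq_iff)
    with assms cochain_expansion[OF finite_K] show False by metis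
  qed
  then obtain F where F: "F \<in> faces K i" "f (orientation F) \<noteq> 0" by blast
  show ?thesis
    unfolding cochain_inner_def
  proof (rule sum_pos2[OF finite_faces[OF finite_K] F(1)])
    show "0 < w F * f (orientation F) * f (orientation F)"
      using F(2) faces_weight_pos[OF F(1)]
      by (simp add: mult.assoc zero_less_mult_iff flip: power2_eq_square)
    show "0 \<le> w G * f (orientation G) * f (orientation G)" if "G \<in> faces K i" for G
      using faces_weight_pos[OF that] by (simp add: mult.assoc)
  qed
qed

text \<open>The sum defining \<open>eigenvalues\<close> is meaningful only over a finite set. One
  nonzero eigenvector per eigenvalue gives an orthogonal, hence independent, family inside the span
  of finitely many elementary cochains.\<close>

lemma finite_eigenvalues:
  "finite {a. \<exists>f\<in>eigenspace (cochains K i) (up_laplacian w K i) a. f \<noteq> 0}" (is "finite ?A")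
proof -
  let ?E = "eigenspace (cochains K i) (up_laplacian w K i)"
  obtain e where e: "e a \<in> ?E a" "e a \<noteq> 0" if "a \<in> ?A" for a
  proof -
    have "\<forall>a. \<exists>f. a \<in> ?A \<longrightarrow> f \<in> ?E a \<and> f \<noteq> 0" by blast
    then obtain e where "\<forall>a. a \<in> ?A \<longrightarrow> e a \<in> ?E a \<and> e a \<noteq> 0" by (rule choice[THEN exE])
    then show ?thesis using that by blast
  qed
  have cochain: "e a \<in> cochains K i" if "a \<in> ?A" for a
    using e(1)[OF that] by (simp add: eigenspace_def)
  have orth: "cochain_inner w K i (e a) (e b) = 0" if "a \<in> ?A" "b \<in> ?A" "a \<noteq> b" for a b
    using eigenspaces_orthogonal e(1) that by blast
  have pos: "cochain_inner w K i (e a) (e a) > 0" if "a \<in> ?A" for a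
    using cochain_inner_self_pos cochain e(2) that by blast
  have inj: "inj_on e ?A"
  proof (rule inj_onI)
    fix a b assume "a \<in> ?A" "b \<in> ?A" "e a = e b"
    then show "a = b" using orth[of a b] pos[of a] by (metis less_irrefl)
  qed
  have "real_fun.independent (e ` ?A)"
    unfolding real_fun.independent_explicit_finite_subsets
  proof (intro allI impI ballI)
    fix S and c :: "('a list \<Rightarrow> real) \<Rightarrow> real" and f
    assume S: "S \<subseteq> e ` ?A" "finite S" and 0: "(\<Sum>f\<in>S. fun_scale (c f) f) = 0" and f: "f \<in> S"
    \<comment> \<open>Pairing the vanishing combination with \<open>f\<close> leaves only the term
      of \<open>f\<close>, by orthogonality.\<close>
    have "0 = (\<Sum>g\<in>S. c g * cochain_inner w K i f g)"
      using cochain_inner_sum_right[of w K i f c "\<lambda>f. f" S] by (simp only: 0 cochain_inner_zero_right)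
    also have "\<dots> = (\<Sum>g\<in>S. if g = f then c f * cochain_inner w K i f f else 0)"
    proof (rule sum.cong[OF refl])
      fix g assume "g \<in> S"
      with S f obtain a b where "a \<in> ?A" "b \<in> ?A" "f = e a" "g = e b" by blast
      then show "c g * cochain_inner w K i f g = (if g = f then c f * cochain_inner w K i f f else 0)"
        using orth[of a b] by auto
    qed
    also have "\<dots> = c f * cochain_inner w K i f f" using S f by simp
    moreover have "cochain_inner w K i f f > 0" using S f pos by blast
    ultimately show "c f = 0" by simp
  qed
  moreover have "e ` ?A \<subseteq> real_fun.span (basis_cochain ` faces K i)"
    using cochain cochains_subset_span[OF finite_K] by blast
  ultimately have "finite (e ` ?A)"
    using real_fun.independent_span_bound[OF finite_imageI[OF finite_faces[OF finite_K]]] by blast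
  then show ?thesis using inj by (rule finite_imageD)
qed

text \<open>A number that is not an eigenvalue does not occur in the multiset, and its eigenspace
  has dimension zero, so the formula covers every \<open>a\<close>.\<close>

lemma count_eigenvalues:
  "count (eigenvalues (cochains K i) (up_laplacian w K i)) a
     = real_fun.dim (eigenspace (cochains K i) (up_laplacian w K i) a)"
proof -
  let ?E = "eigenspace (cochains K i) (up_laplacian w K i)"
  have "real_fun.dim (?E a) = 0" if "\<forall>f\<in>?E a. f = 0"
  proof -
    have "?E a \<subseteq> real_fun.span {}" using that by auto
    then show ?thesis using real_fun.dim_le_card[of "?E a" "{}"] by simp
  qed
  then show ?thesis
    using finite_eigenvalues[of i] by (auto simp: eigenvalues_def count_sum)
qed

end

section \<open>Dimensions of direct sums and of injective images\<close>

lemma dim_direct_sum: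
  assumes V: "real_fun.subspace V" "V \<subseteq> real_fun.span S" "finite S"
    and W: "real_fun.subspace W" "W \<subseteq> real_fun.span T" "finite T"
    and 0: "V \<inter> W \<subseteq> {0}"
  shows "real_fun.dim {x + y | x y. x \<in> V \<and> y \<in> W} = real_fun.dim V + real_fun.dim W"
proof -
  obtain B where B: "B \<subseteq> V" "real_fun.independent B" "V \<subseteq> real_fun.span B" "card B = real_fun.dim V"
    using real_fun.basis_exists .
  obtain C where C: "C \<subseteq> W" "real_fun.independent C" "W \<subseteq> real_fun.span C" "card C = real_fun.dim W"
    using real_fun.basis_exists .
  \<comment> \<open>The ambient function space may be infinite-dimensional; finiteness comes from
    the spanning sets \<open>S\<close> and \<open>T\<close>.\<close>
  have fin: "finite B" "finite C"
    using real_fun.independent_span_bound[OF V(3) B(2)] real_fun.independent_span_bound[OF W(3) C(2)]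
      B(1) C(1) V(2) W(2) by auto
  have disj: "B \<inter> C = {}"
    using B(1,2) C(1) 0 real_fun.dependent_zero by blast
  have sub: "V \<subseteq> {x + y | x y. x \<in> V \<and> y \<in> W}" "W \<subseteq> {x + y | x y. x \<in> V \<and> y \<in> W}"
    using real_fun.subspace_0[OF V(1)] real_fun.subspace_0[OF W(1)]
    by (metis (mono_tags, lifting) add.right_neutral add.left_neutral mem_Collect_eq subsetI)+
  have "real_fun.independent (B \<union> C)"
  proof (rule real_fun.independent_if_scalars_zero)
    fix c x assume sum: "(\<Sum>x\<in>B \<union> C. fun_scale (c x) x) = 0" and x: "x \<in> B \<union> C"
    let ?b = "\<Sum>x\<in>B. fun_scale (c x) x" and ?c = "\<Sum>x\<in>C. fun_scale (c x) x"
    \<comment> \<open>The part of the relation over \<open>B\<close> is the negative of the part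
      over \<open>C\<close>. It therefore lies in both subspaces and vanishes, and each basis can be
      treated by itself.\<close>
    have bc: "?b + ?c = 0" using sum fin disj by (simp add: sum.union_disjoint)
    have "?b \<in> V" using B by (intro real_fun.subspace_sum V real_fun.subspace_scale) auto
    moreover have "?c \<in> W" using C by (intro real_fun.subspace_sum W real_fun.subspace_scale) auto
    moreover have "?b = - ?c" using bc by (simp add: eq_neg_iff_add_eq_0)
    ultimately have "?b \<in> V \<inter> W" using real_fun.subspace_neg[OF W(1)] by auto
    then have "?b = 0" "?c = 0" using 0 bc by auto
    then show "c x = 0"
      using x fin B(2) C(2) real_fun.independentD[of B B c] real_fun.independentD[of C C c] by blast
  qed (use fin in simp)
  moreover have "{x + y | x y. x \<in> V \<and> y \<in> W} \<subseteq> real_fun.span (B \<union> C)"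
    using B(3) C(3) unfolding real_fun.span_Un by blast
  moreover have "B \<union> C \<subseteq> {x + y | x y. x \<in> V \<and> y \<in> W}" using B(1) C(1) sub by blast
  ultimately have "card (B \<union> C) = real_fun.dim {x + y | x y. x \<in> V \<and> y \<in> W}"
    by (intro real_fun.basis_card_eq_dim)
  then show ?thesis using B(4) C(4) fin disj by (simp add: card_Un_disjoint)
qed

text \<open>Injectivity is asked on \<open>S\<close> only, because the intended map
  \<open>pullback\<close> forgets the values at lists outside an image and so is in general not
  injective on all functions.\<close>

lemma dim_linear_image:
  assumes P: "Vector_Spaces.linear fun_scale fun_scale P" and S: "real_fun.subspace S" "inj_on P S"
  shows "real_fun.dim (P ` S) = real_fun.dim S"
proof -
  interpret Vector_Spaces.linear fun_scale fun_scale P by (rule P)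
  obtain B where B: "B \<subseteq> S" "real_fun.independent B" "S \<subseteq> real_fun.span B" "card B = real_fun.dim S"
    using real_fun.basis_exists .
  have span: "real_fun.span B = S" using B(1,3) S(1) real_fun.span_minimal by blast
  have "real_fun.independent (P ` B)"
    using independent_injective_image[OF B(2)] S(2) span by simp
  moreover have "P ` S \<subseteq> real_fun.span (P ` B)" using span span_image[of B] by simp
  ultimately have "card (P ` B) = real_fun.dim (P ` S)"
    using B(1) by (intro real_fun.basis_card_eq_dim) auto
  then show ?thesis using B(1,4) S(2) by (metis card_image inj_on_subset)
qed

section \<open>Positivity of the normalized weight, and multiplicities as dimensions\<close>

lemma simplicial_complexD:
  assumes "simplicial_complex K"
  shows "finite K" "F \<in> K \<Longrightarrow> finite F" "F \<in> K \<Longrightarrow> G \<subseteq> F \<Longrightarrow> G \<in> K"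
  using assms by (auto simp: simplicial_complex_def)

text \<open>A face that is not a facet lies properly in some \<open>G\<close>. Adding one vertex of
  \<open>G\<close> gives, by closure under inclusion, a face with exactly one more vertex, so the
  degree is a nonempty sum of positive terms.\<close>

lemma normalized_weight_pos:
  assumes "simplicial_complex K" "F \<in> K"
  shows "normalized_weight K F > 0"
  using assms
proof (induction K F rule: normalized_weight.induct)
  case (1 K F)
  note K = simplicial_complexD[OF "1.prems"(1)]
  show ?case
  proof (cases "facet K F")
    case False
    let ?A = "{G \<in> K. F \<subset> G \<and> card G = card F + 1}"
    from False "1.prems"(2) obtain G where G: "G \<in> K" "F \<subset> G" by (auto simp: facet_def)
    then obtain x where "x \<in> G - F" by blast
    with G K "1.prems"(2) have "insert x F \<in> ?A" by auto
    then have "?A \<noteq> {}" by blast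
    moreover have "normalized_weight K G > 0" if "G \<in> ?A" for G
      using "1.IH" "1.prems" False K(1) that by blast
    ultimately have "(\<Sum>G\<in>?A. normalized_weight K G) > 0"
      using K(1) by (intro sum_pos) auto
    then show ?thesis
      using False by (simp only: normalized_weight_eq[OF K(1) "1.prems"(2)] degree_def if_False)
  next
    case True
    then show ?thesis by (simp only: normalized_weight_eq[OF K(1) "1.prems"(2)]) simp
  qed
qed

lemma weighted_complex_normalized:
  "simplicial_complex K \<Longrightarrow> weighted_complex K (normalized_weight K)"
  by (simp add: weighted_complex_def simplicial_complexD(1) normalized_weight_pos)

definition up_eigenspace :: "'a set set \<Rightarrow> nat \<Rightarrow> real \<Rightarrow> ('a list \<Rightarrow> real) set" where
  "up_eigenspace K i a = eigenspace (cochains K i) (normalized_up_laplacian K i) a"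

text \<open>The Dirichlet form of the normalized up-Laplacian.\<close>

definition energy :: "'a set set \<Rightarrow> nat \<Rightarrow> ('a list \<Rightarrow> real) \<Rightarrow> ('a list \<Rightarrow> real) \<Rightarrow> real" where
  "energy K i f g =
     cochain_inner (normalized_weight K) K (i + 1) (coboundary K i f) (coboundary K i g)"

lemma energy_zero_left [simp]: "energy K j 0 f = 0"
  by (simp add: energy_def coboundary_zero)

abbreviation normalized_inner ::
  "'a set set \<Rightarrow> nat \<Rightarrow> ('a list \<Rightarrow> real) \<Rightarrow> ('a list \<Rightarrow> real) \<Rightarrow> real" where
  "normalized_inner K \<equiv> cochain_inner (normalized_weight K) K"

lemma count_up_spectrum:
  "simplicial_complex K \<Longrightarrow> count (up_spectrum K i) a = real_fun.dim (up_eigenspace K i a)"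
  by (simp add: up_spectrum_def up_eigenspace_def normalized_up_laplacian_def
      weighted_complex.count_eigenvalues weighted_complex_normalized)

lemma up_eigenspace_iff:
  "simplicial_complex K \<Longrightarrow> f \<in> up_eigenspace K i a \<longleftrightarrow> f \<in> cochains K i \<and>
     (\<forall>g\<in>cochains K i. energy K i g f = a * normalized_inner K i g f)"
  by (simp add: up_eigenspace_def normalized_up_laplacian_def energy_def
      weighted_complex.eigenspace_iff weighted_complex_normalized)

lemma subspace_up_eigenspace:
  "simplicial_complex K \<Longrightarrow> real_fun.subspace (up_eigenspace K i a)"
  by (simp add: up_eigenspace_def normalized_up_laplacian_def
      weighted_complex.subspace_eigenspace weighted_complex_normalized)

lemma up_eigenspace_subset: "up_eigenspace K i a \<subseteq> cochains K i"
  by (auto simp: up_eigenspace_def eigenspace_def)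

section \<open>Unions of complexes without common faces of high dimension\<close>

text \<open>The recursion for the weight only visits faces containing \<open>F\<close>, and these
  are the same in both complexes. The last hypothesis passes to every coface by transitivity of
  inclusion.\<close>

lemma normalized_weight_upward_closed:
  assumes "finite L" "K \<subseteq> L" "F \<in> K" "\<And>G. G \<in> L \<Longrightarrow> F \<subseteq> G \<Longrightarrow> G \<in> K"
  shows "normalized_weight L F = normalized_weight K F"
  using assms
proof (induction L F rule: normalized_weight.induct)
  case (1 L F)
  have K: "finite K" "F \<in> L" using "1.prems" finite_subset by auto
  note eqL = normalized_weight_eq[OF "1.prems"(1) K(2)]
    and eqK = normalized_weight_eq[OF K(1) "1.prems"(3)]
  have facet: "facet L F \<longleftrightarrow> facet K F" using "1.prems" by (auto simp: facet_def)
  show ?case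
  proof (cases "facet L F")
    case False
    have "{G \<in> L. F \<subset> G \<and> card G = card F + 1} = {G \<in> K. F \<subset> G \<and> card G = card F + 1}"
      using "1.prems" by auto
    moreover have "normalized_weight L G = normalized_weight K G"
      if "G \<in> {G \<in> L. F \<subset> G \<and> card G = card F + 1}" for G
    proof (rule "1.IH")
      show "H \<in> K" if "H \<in> L" "G \<subseteq> H" for H
        using "1.prems"(4) that \<open>G \<in> _\<close> by blast
    qed (use "1.prems" K False that in auto)
    ultimately show ?thesis
      using False facet
      by (simp only: eqL eqK degree_def if_False) (auto intro: sum.cong)
  next
    case True
    with facet show ?thesis by (simp only: eqL eqK if_True)
  qed
qed

text \<open>Restriction followed by extension by zero: cochains of a subcomplex remain cochains of
  the whole complex, so that both summands lie in one function space.\<close>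

definition restrict_cochain ::
  "'a set set \<Rightarrow> nat \<Rightarrow> ('a list \<Rightarrow> real) \<Rightarrow> 'a list \<Rightarrow> real" where
  "restrict_cochain K i f = (\<lambda>xs. if set xs \<in> faces K i then f xs else 0)"

lemma restrict_cochain_in:
  "f \<in> cochains L i \<Longrightarrow> restrict_cochain K i f \<in> cochains K i"
  by (auto simp: cochains_def restrict_cochain_def)

lemma restrict_cochain_self: "f \<in> cochains K i \<Longrightarrow> restrict_cochain K i f = f"
  by (auto simp: cochains_def restrict_cochain_def fun_eq_iff)

lemma restrict_cochain_add:
  "restrict_cochain K j (f + g) = restrict_cochain K j f + restrict_cochain K j g"
  by (auto simp: restrict_cochain_def)

lemma faces_mono: "K \<subseteq> L \<Longrightarrow> faces K i \<subseteq> faces L i"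
  by (auto simp: faces_def)

lemma cochains_mono: "K \<subseteq> L \<Longrightarrow> cochains K i \<subseteq> cochains L i"
  using faces_mono[of K L i] by (auto simp: cochains_def)

lemma face_remove:
  assumes "simplicial_complex K" "set xs \<in> faces K (i + 1)" "distinct xs" "j \<le> i + 1"
  shows "set (take j xs @ drop (Suc j) xs) \<in> faces K i" "distinct (take j xs @ drop (Suc j) xs)"
proof -
  have len: "length xs = i + 2" using faces_card[OF assms(2,3)] by simp
  have "distinct (take j xs @ xs ! j # drop (Suc j) xs)"
    using assms(3,4) len by (simp add: id_take_nth_drop[symmetric])
  then show dist: "distinct (take j xs @ drop (Suc j) xs)" by simp
  have "set (take j xs @ drop (Suc j) xs) \<subseteq> set xs"
    by (auto dest: in_set_takeD in_set_dropD)
  then have "set (take j xs @ drop (Suc j) xs) \<in> K"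
    using simplicial_complexD(3)[OF assms(1)] assms(2) by (auto simp: faces_def)
  then show "set (take j xs @ drop (Suc j) xs) \<in> faces K i"
    using distinct_card[OF dist] len assms(4) by (simp add: faces_def)
qed

text \<open>All faces in the boundary of an \<open>(i + 1)\<close>-face of \<open>K\<close> belong
  to \<open>K\<close>, where restriction changes nothing.\<close>

lemma coboundary_restrict_cochain:
  assumes "simplicial_complex K" "K \<subseteq> L" "set xs \<in> faces K (i + 1)" "distinct xs"
  shows "coboundary L i f xs = coboundary K i (restrict_cochain K i f) xs"
proof -
  have "set xs \<in> faces L (i + 1)" using assms faces_mono by blast
  then show ?thesis
    using assms(3,4) face_remove[OF assms(1,3,4)]
    unfolding coboundary_def restrict_cochain_def by (auto intro!: sum.cong)
qed

text \<open>An \<open>i\<close>-face has \<open>i + 1\<close> vertices, so the bound on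
  \<open>card F\<close> excludes exactly the common faces of dimension \<open>i\<close> or
  more.\<close>

locale high_disjoint_union =
  fixes K\<^sub>1 K\<^sub>2 :: "'a set set" and i :: nat
  assumes K\<^sub>1: "simplicial_complex K\<^sub>1" and K\<^sub>2: "simplicial_complex K\<^sub>2"
    and common: "F \<in> K\<^sub>1 \<Longrightarrow> F \<in> K\<^sub>2 \<Longrightarrow> card F \<le> i"
begin

lemma complex_Un: "simplicial_complex (K\<^sub>1 \<union> K\<^sub>2)"
  using K\<^sub>1 K\<^sub>2 unfolding simplicial_complex_def by (metis Un_iff finite_UnI)

lemma faces_Un: "faces (K\<^sub>1 \<union> K\<^sub>2) j = faces K\<^sub>1 j \<union> faces K\<^sub>2 j"
  by (auto simp: faces_def)

lemma faces_disjoint: "j \<ge> i \<Longrightarrow> faces K\<^sub>1 j \<inter> faces K\<^sub>2 j = {}"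
proof -
  assume "j \<ge> i"
  then have False if "F \<in> faces K\<^sub>1 j" "F \<in> faces K\<^sub>2 j" for F
    using common[of F] that by (simp add: faces_def)
  then show ?thesis by blast
qed

text \<open>A coface of \<open>F\<close> in the other summand would, by closure under inclusion,
  place \<open>F\<close> itself there and make it a common face. Hence all cofaces lie in the
  summand of \<open>F\<close>.\<close>

lemma weight_Un:
  assumes "j \<ge> i"
  shows "F \<in> faces K\<^sub>1 j \<Longrightarrow> normalized_weight (K\<^sub>1 \<union> K\<^sub>2) F = normalized_weight K\<^sub>1 F"
    "F \<in> faces K\<^sub>2 j \<Longrightarrow> normalized_weight (K\<^sub>1 \<union> K\<^sub>2) F = normalized_weight K\<^sub>2 F"
proof -
  have *: "\<not> (F \<in> K\<^sub>1 \<and> F \<in> K\<^sub>2)" if "card F = j + 1"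
    using common[of F] assms that by linarith
  have sub: "F \<in> K\<^sub>1" if "G \<in> K\<^sub>1" "F \<subseteq> G" for G
    using simplicial_complexD(3)[OF K\<^sub>1] that .
  have sub': "F \<in> K\<^sub>2" if "G \<in> K\<^sub>2" "F \<subseteq> G" for G
    using simplicial_complexD(3)[OF K\<^sub>2] that .
  show "normalized_weight (K\<^sub>1 \<union> K\<^sub>2) F = normalized_weight K\<^sub>1 F" if "F \<in> faces K\<^sub>1 j"
    using that simplicial_complexD(1)[OF complex_Un] * sub'
    by (intro normalized_weight_upward_closed) (auto simp: faces_def)
  show "normalized_weight (K\<^sub>1 \<union> K\<^sub>2) F = normalized_weight K\<^sub>2 F" if "F \<in> faces K\<^sub>2 j"
    using that simplicial_complexD(1)[OF complex_Un] * sub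
    by (intro normalized_weight_upward_closed) (auto simp: faces_def)
qed

text \<open>Admitting every \<open>j \<ge> i\<close> serves both the inner product of
  \<open>i\<close>-cochains and, with \<open>j = i + 1\<close>, the energy. The hypotheses compare
  products only, which is all that the inner product sees.\<close>

lemma inner_Un:
  assumes "j \<ge> i"
    and "\<And>xs. distinct xs \<Longrightarrow> set xs \<in> faces K\<^sub>1 j \<Longrightarrow> f xs * g xs = f\<^sub>1 xs * g\<^sub>1 xs"
    and "\<And>xs. distinct xs \<Longrightarrow> set xs \<in> faces K\<^sub>2 j \<Longrightarrow> f xs * g xs = f\<^sub>2 xs * g\<^sub>2 xs"
  shows "normalized_inner (K\<^sub>1 \<union> K\<^sub>2) j f g = normalized_inner K\<^sub>1 j f\<^sub>1 g\<^sub>1 + normalized_inner K\<^sub>2 j f\<^sub>2 g\<^sub>2"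
proof -
  have fin: "finite (faces K\<^sub>1 j)" "finite (faces K\<^sub>2 j)"
    using K\<^sub>1 K\<^sub>2 by (simp_all add: finite_faces simplicial_complexD(1))
  have or: "f (orientation F) * g (orientation F) = f\<^sub>1 (orientation F) * g\<^sub>1 (orientation F)"
    if "F \<in> faces K\<^sub>1 j" for F
    using that assms(2)[of "orientation F"] by (simp add: orientation faces_finite)
  have or': "f (orientation F) * g (orientation F) = f\<^sub>2 (orientation F) * g\<^sub>2 (orientation F)"
    if "F \<in> faces K\<^sub>2 j" for F
    using that assms(3)[of "orientation F"] by (simp add: orientation faces_finite)
  show ?thesis
    unfolding cochain_inner_def faces_Un sum.union_disjoint[OF fin faces_disjoint[OF assms(1)]]
    by (intro arg_cong2[of _ _ _ _ "(+)"] sum.cong)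
      (simp_all add: mult.assoc or or' weight_Un[OF assms(1)])
qed

lemma energy_Un:
  "energy (K\<^sub>1 \<union> K\<^sub>2) i f g =
     energy K\<^sub>1 i (restrict_cochain K\<^sub>1 i f) (restrict_cochain K\<^sub>1 i g) +
     energy K\<^sub>2 i (restrict_cochain K\<^sub>2 i f) (restrict_cochain K\<^sub>2 i g)"
  unfolding energy_def
proof (rule inner_Un)
  show "coboundary (K\<^sub>1 \<union> K\<^sub>2) i f xs * coboundary (K\<^sub>1 \<union> K\<^sub>2) i g xs =
      coboundary K\<^sub>1 i (restrict_cochain K\<^sub>1 i f) xs * coboundary K\<^sub>1 i (restrict_cochain K\<^sub>1 i g) xs"
    if "distinct xs" "set xs \<in> faces K\<^sub>1 (i + 1)" for xs
    by (simp only: coboundary_restrict_cochain[OF K\<^sub>1 Un_upper1 that(2,1)])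
  show "coboundary (K\<^sub>1 \<union> K\<^sub>2) i f xs * coboundary (K\<^sub>1 \<union> K\<^sub>2) i g xs =
      coboundary K\<^sub>2 i (restrict_cochain K\<^sub>2 i f) xs * coboundary K\<^sub>2 i (restrict_cochain K\<^sub>2 i g) xs"
    if "distinct xs" "set xs \<in> faces K\<^sub>2 (i + 1)" for xs
    by (simp only: coboundary_restrict_cochain[OF K\<^sub>2 Un_upper2 that(2,1)])
qed simp

lemma normalized_inner_Un:
  "normalized_inner (K\<^sub>1 \<union> K\<^sub>2) i f g =
     normalized_inner K\<^sub>1 i (restrict_cochain K\<^sub>1 i f) (restrict_cochain K\<^sub>1 i g) +
     normalized_inner K\<^sub>2 i (restrict_cochain K\<^sub>2 i f) (restrict_cochain K\<^sub>2 i g)"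
  by (rule inner_Un) (simp_all add: restrict_cochain_def)

lemma restrict_cochain_other:
  "f \<in> cochains K\<^sub>1 i \<Longrightarrow> restrict_cochain K\<^sub>2 i f = 0"
  "f \<in> cochains K\<^sub>2 i \<Longrightarrow> restrict_cochain K\<^sub>1 i f = 0"
  using faces_disjoint[OF order_refl]
  by (auto simp: restrict_cochain_def cochains_def fun_eq_iff)

lemma cochain_split:
  assumes "f \<in> cochains (K\<^sub>1 \<union> K\<^sub>2) i"
  shows "f = restrict_cochain K\<^sub>1 i f + restrict_cochain K\<^sub>2 i f"
proof
  fix xs
  have "\<not> (set xs \<in> faces K\<^sub>1 i \<and> set xs \<in> faces K\<^sub>2 i)"
    using faces_disjoint[OF order_refl] by blast
  then show "f xs = (restrict_cochain K\<^sub>1 i f + restrict_cochain K\<^sub>2 i f) xs"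
    using assms by (auto simp: restrict_cochain_def cochains_def faces_Un)
qed

text \<open>Forwards, the equation is tested on cochains of one summand: they restrict to zero on
  the other, so only the terms of their own summand survive. Backwards, the two equations for the
  restricted test cochain are added.\<close>

lemma up_eigenspace_Un_iff:
  "f \<in> up_eigenspace (K\<^sub>1 \<union> K\<^sub>2) i a \<longleftrightarrow> f \<in> cochains (K\<^sub>1 \<union> K\<^sub>2) i \<and>
     restrict_cochain K\<^sub>1 i f \<in> up_eigenspace K\<^sub>1 i a \<and>
     restrict_cochain K\<^sub>2 i f \<in> up_eigenspace K\<^sub>2 i a" (is "?l \<longleftrightarrow> ?r")
proof
  assume l: ?l
  then have f: "f \<in> cochains (K\<^sub>1 \<union> K\<^sub>2) i" using up_eigenspace_subset by blast
  have eq: "energy (K\<^sub>1 \<union> K\<^sub>2) i g f = a * normalized_inner (K\<^sub>1 \<union> K\<^sub>2) i g f"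
    if "g \<in> cochains K\<^sub>1 i \<or> g \<in> cochains K\<^sub>2 i" for g
  proof -
    have "g \<in> cochains (K\<^sub>1 \<union> K\<^sub>2) i"
      using that cochains_mono[of K\<^sub>1 "K\<^sub>1 \<union> K\<^sub>2" i] cochains_mono[of K\<^sub>2 "K\<^sub>1 \<union> K\<^sub>2" i] by blast
    then show ?thesis using l complex_Un by (simp add: up_eigenspace_iff)
  qed
  have "energy K\<^sub>1 i g (restrict_cochain K\<^sub>1 i f) = a * normalized_inner K\<^sub>1 i g (restrict_cochain K\<^sub>1 i f)"
    if "g \<in> cochains K\<^sub>1 i" for g
    using eq[of g] that
    by (simp add: energy_Un normalized_inner_Un restrict_cochain_other restrict_cochain_self)
  moreover have "energy K\<^sub>2 i g (restrict_cochain K\<^sub>2 i f) = a * normalized_inner K\<^sub>2 i g (restrict_cochain K\<^sub>2 i f)"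
    if "g \<in> cochains K\<^sub>2 i" for g
    using eq[of g] that
    by (simp add: energy_Un normalized_inner_Un restrict_cochain_other restrict_cochain_self)
  ultimately show ?r
    using f by (simp add: up_eigenspace_iff K\<^sub>1 K\<^sub>2 restrict_cochain_in)
next
  assume ?r
  then show ?l
    by (simp add: up_eigenspace_iff[OF complex_Un] up_eigenspace_iff[OF K\<^sub>1] up_eigenspace_iff[OF K\<^sub>2]
        energy_Un normalized_inner_Un restrict_cochain_in distrib_left)
qed

lemma up_eigenspace_Un:
  "up_eigenspace (K\<^sub>1 \<union> K\<^sub>2) i a = {f + g | f g. f \<in> up_eigenspace K\<^sub>1 i a \<and> g \<in> up_eigenspace K\<^sub>2 i a}"
proof (intro equalityI subsetI)
  fix f assume "f \<in> up_eigenspace (K\<^sub>1 \<union> K\<^sub>2) i a"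
  then show "f \<in> {f + g | f g. f \<in> up_eigenspace K\<^sub>1 i a \<and> g \<in> up_eigenspace K\<^sub>2 i a}"
    unfolding up_eigenspace_Un_iff using cochain_split by blast
next
  fix h assume "h \<in> {f + g | f g. f \<in> up_eigenspace K\<^sub>1 i a \<and> g \<in> up_eigenspace K\<^sub>2 i a}"
  then obtain f g where h: "h = f + g" and f: "f \<in> up_eigenspace K\<^sub>1 i a" and g: "g \<in> up_eigenspace K\<^sub>2 i a"
    by blast
  have f': "f \<in> cochains K\<^sub>1 i" and g': "g \<in> cochains K\<^sub>2 i"
    using f g up_eigenspace_subset by blast+
  then have "h \<in> cochains (K\<^sub>1 \<union> K\<^sub>2) i"
    unfolding h using cochains_mono[of K\<^sub>1 "K\<^sub>1 \<union> K\<^sub>2" i] cochains_mono[of K\<^sub>2 "K\<^sub>1 \<union> K\<^sub>2" i]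
    by (intro real_fun.subspace_add[OF subspace_cochains]) auto
  moreover have "restrict_cochain K\<^sub>1 i h = f" "restrict_cochain K\<^sub>2 i h = g"
    using f' g' by (simp_all add: h restrict_cochain_add restrict_cochain_self restrict_cochain_other)
  ultimately show "h \<in> up_eigenspace (K\<^sub>1 \<union> K\<^sub>2) i a"
    using f g by (simp add: up_eigenspace_Un_iff)
qed

lemma dim_up_eigenspace_Un:
  "real_fun.dim (up_eigenspace (K\<^sub>1 \<union> K\<^sub>2) i a) =
     real_fun.dim (up_eigenspace K\<^sub>1 i a) + real_fun.dim (up_eigenspace K\<^sub>2 i a)"
  unfolding up_eigenspace_Un
proof (rule dim_direct_sum)
  show "up_eigenspace K\<^sub>1 i a \<subseteq> real_fun.span (basis_cochain ` faces K\<^sub>1 i)"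
    "up_eigenspace K\<^sub>2 i a \<subseteq> real_fun.span (basis_cochain ` faces K\<^sub>2 i)"
    using up_eigenspace_subset cochains_subset_span simplicial_complexD(1) K\<^sub>1 K\<^sub>2 by blast+
  \<comment> \<open>A cochain of both summands equals its own restriction to the second, which is
    zero because it is a cochain of the first.\<close>
  show "up_eigenspace K\<^sub>1 i a \<inter> up_eigenspace K\<^sub>2 i a \<subseteq> {0}"
  proof
    fix f assume "f \<in> up_eigenspace K\<^sub>1 i a \<inter> up_eigenspace K\<^sub>2 i a"
    then have "f \<in> cochains K\<^sub>1 i" "f \<in> cochains K\<^sub>2 i" using up_eigenspace_subset by blast+
    then show "f \<in> {0}" using restrict_cochain_other(1) restrict_cochain_self by fastforce
  qed
qed (use K\<^sub>1 K\<^sub>2 in \<open>simp_all add: subspace_up_eigenspace finite_faces simplicial_complexD(1)\<close>)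

end

section \<open>Invariance under isomorphism\<close>

text \<open>The guard is needed because \<phi> will be controlled on \<open>V\<close> only:
  elsewhere it may hit vertices of the target, and the pullback of a cochain would not vanish off
  the faces.\<close>

definition pullback :: "'a set \<Rightarrow> ('a \<Rightarrow> 'b) \<Rightarrow> ('b list \<Rightarrow> real) \<Rightarrow> 'a list \<Rightarrow> real" where
  "pullback V \<phi> f = (\<lambda>xs. if set xs \<subseteq> V then f (map \<phi> xs) else 0)"

lemma linear_pullback: "Vector_Spaces.linear fun_scale fun_scale (pullback V \<phi>)"
  by unfold_locales (auto simp: pullback_def fun_scale_def fun_eq_iff algebra_simps)

text \<open>An isomorphism of \<open>K\<close> onto its image complex. The wedge sum is a union of
  two such images.\<close>

locale complex_embedding =
  fixes K :: "'a set set" and \<phi> :: "'a \<Rightarrow> 'b"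
  assumes K: "simplicial_complex K" and inj: "inj_on \<phi> (\<Union>K)"
begin

abbreviation "L \<equiv> (`) \<phi> ` K"
abbreviation "P \<equiv> pullback (\<Union>K) \<phi>"

lemma inj_image: "inj_on ((`) \<phi>) (Pow (\<Union>K))"
  using inj by (rule inj_on_image_Pow)

lemma inj_faces: "A \<subseteq> K \<Longrightarrow> inj_on ((`) \<phi>) A"
  by (rule inj_on_subset[OF inj_image]) auto

lemma inj_on_face: "F \<in> K \<Longrightarrow> inj_on \<phi> F"
  by (rule inj_on_subset[OF inj]) auto

lemma image_subset_iff_face: 
  assumes "F \<in> K" "G \<in> K"
  shows "\<phi> ` F \<subseteq> \<phi> ` G \<longleftrightarrow> F \<subseteq> G"
proof
  assume sub: "\<phi> ` F \<subseteq> \<phi> ` G"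
  show "F \<subseteq> G"
  proof
    fix x assume "x \<in> F"
    with sub obtain y where "y \<in> G" "\<phi> x = \<phi> y" by blast
    with \<open>x \<in> F\<close> assms show "x \<in> G" using inj_onD[OF inj, of x y] by blast
  qed
qed blast

lemma image_psubset_iff_face: "F \<in> K \<Longrightarrow> G \<in> K \<Longrightarrow> \<phi> ` F \<subset> \<phi> ` G \<longleftrightarrow> F \<subset> G"
  by (simp only: less_le_not_le image_subset_iff_face)

lemma card_image_face: "F \<in> K \<Longrightarrow> card (\<phi> ` F) = card F"
  by (rule card_image[OF inj_on_face])

lemma simplicial_image: "simplicial_complex L"
  using K unfolding simplicial_complex_def by (auto simp: subset_image_iff)

lemma faces_image: "faces L j = (`) \<phi> ` faces K j"
  using K by (auto simp: faces_def card_image_face simplicial_complexD(2))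

lemma image_in_faces_iff: "F \<subseteq> \<Union>K \<Longrightarrow> \<phi> ` F \<in> faces L j \<longleftrightarrow> F \<in> faces K j"
  unfolding faces_image
  by (rule inj_on_image_mem_iff[OF inj_image]) (auto simp: faces_def)

lemma normalized_weight_image:
  assumes "F \<in> K"
  shows "normalized_weight L (\<phi> ` F) = normalized_weight K F"
  using assms
\<comment> \<open>The number of proper cofaces is the termination measure of the weight.\<close>
proof (induction "card {G \<in> K. F \<subset> G}" arbitrary: F rule: less_induct)
  case less
  have fin: "finite K" using K by (rule simplicial_complexD)
  have eqL: "normalized_weight L (\<phi> ` F) =
      (if facet L (\<phi> ` F) then 1 else degree (normalized_weight L) L (\<phi> ` F))"
    using fin less.prems by (intro normalized_weight_eq) auto
  note eqK = normalized_weight_eq[OF fin less.prems]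
  have facet: "facet L (\<phi> ` F) \<longleftrightarrow> facet K F"
    using less.prems by (auto simp: facet_def image_psubset_iff_face)
  show ?case
  proof (cases "facet K F")
    case False
    have IH: "normalized_weight L (\<phi> ` G) = normalized_weight K G" if "G \<in> K" "F \<subset> G" for G
    proof (rule less.hyps)
      have "{H \<in> K. G \<subset> H} \<subset> {H \<in> K. F \<subset> H}" using that by auto
      then show "card {H \<in> K. G \<subset> H} < card {H \<in> K. F \<subset> H}"
        using fin by (intro psubset_card_mono) auto
    qed (rule that)
    \<comment> \<open>The index set of the degree is first written as an image under \<phi>;
      injectivity then removes \<phi> from the conditions, and the sum is reindexed.\<close>
    have "{G \<in> L. \<phi> ` F \<subset> G \<and> card G = card (\<phi> ` F) + 1} =
        (`) \<phi> ` {G \<in> K. \<phi> ` F \<subset> \<phi> ` G \<and> card (\<phi> ` G) = card (\<phi> ` F) + 1}"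
      by blast
    moreover have "{G \<in> K. \<phi> ` F \<subset> \<phi> ` G \<and> card (\<phi> ` G) = card (\<phi> ` F) + 1} =
        {G \<in> K. F \<subset> G \<and> card G = card F + 1}"
      using less.prems
      by (intro Collect_cong conj_cong refl) (simp_all only: image_psubset_iff_face card_image_face)
    ultimately have "(\<Sum>G\<in>{G \<in> L. \<phi> ` F \<subset> G \<and> card G = card (\<phi> ` F) + 1}. normalized_weight L G) =
        (\<Sum>G\<in>{G \<in> K. F \<subset> G \<and> card G = card F + 1}. normalized_weight K G)"
      using IH by (simp add: sum.reindex[OF inj_faces])
    then show ?thesis
      using False facet by (simp only: eqL eqK degree_def if_False)
  next
    case True
    with facet show ?thesis by (simp only: eqL eqK if_True)
  qed
qed

lemma pullback_cochain:
  assumes "f \<in> cochains L i"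
  shows "P f \<in> cochains K i"
  unfolding cochains_iff
proof (intro conjI allI impI)
  fix xs assume "\<not> (distinct xs \<and> set xs \<in> faces K i)"
  then show "P f xs = 0"
    using assms image_in_faces_iff[of "set xs" i]
    by (auto simp: pullback_def cochains_def distinct_map)
next
  show "alternating (P f)"
    using assms by (auto simp: alternating_def pullback_def cochains_def permute_list_map[symmetric])
qed

text \<open>Deleting an entry commutes with applying \<phi> entrywise, and \<phi> matches the faces
  of \<open>K\<close> with those of \<open>L\<close>. On lists leaving the vertex set both sides are
  zero.\<close>

lemma coboundary_pullback: "coboundary K i (P f) = P (coboundary L i f)"
proof
  fix xs
  show "coboundary K i (P f) xs = P (coboundary L i f) xs"
  proof (cases "set xs \<subseteq> \<Union>K")
    case True
    then have "distinct (map \<phi> xs) \<longleftrightarrow> distinct xs"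
      by (simp add: distinct_map inj_on_subset[OF inj])
    moreover have "set (take j xs @ drop (Suc j) xs) \<subseteq> \<Union>K" for j
      using True by (auto dest: in_set_takeD in_set_dropD)
    ultimately show ?thesis
      using True image_in_faces_iff[OF True, of "Suc i"]
      by (simp add: coboundary_def pullback_def take_map drop_map)
  next
    case False
    then have "set xs \<notin> faces K (i + 1)" by (auto simp: faces_def)
    with False show ?thesis by (auto simp: coboundary_def pullback_def)
  qed
qed

text \<open>The image of the reference orientation of \<open>F\<close> need not be that of the image
  face, but a product of two alternating functions does not see the difference. Assuming only
  \<open>alternating\<close> lets the lemma apply to coboundaries as well.\<close>

lemma inner_pullback:
  assumes "alternating f" "alternating g"
  shows "normalized_inner K i (P f) (P g) = normalized_inner L i f g"
proof -
  have "inj_on ((`) \<phi>) (faces K i)" by (rule inj_faces) (auto simp: faces_def)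
  then show ?thesis
    unfolding cochain_inner_def faces_image
  proof (subst sum.reindex, assumption, intro sum.cong refl)
    fix F assume F: "F \<in> faces K i"
    then have "F \<in> K" by (simp add: faces_def)
    have o: "distinct (orientation F)" "set (orientation F) = F"
      using F by (auto simp: orientation faces_finite)
    then have "f (map \<phi> (orientation F)) * g (map \<phi> (orientation F)) =
        f (orientation (\<phi> ` F)) * g (orientation (\<phi> ` F))"
      using alternating_mult_orientation[OF assms, of "map \<phi> (orientation F)"] inj_on_face[OF \<open>F \<in> K\<close>]
      by (simp add: distinct_map)
    moreover have "P h (orientation F) = h (map \<phi> (orientation F))" for h
      using o \<open>F \<in> K\<close> by (auto simp: pullback_def)
    ultimately show "normalized_weight K F * P f (orientation F) * P g (orientation F) =
        ((\<lambda>F. normalized_weight L F * f (orientation F) * g (orientation F)) \<circ> (`) \<phi>) F"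
      using \<open>F \<in> K\<close> by (simp add: normalized_weight_image mult.assoc)
  qed
qed

lemma energy_pullback:
  assumes "alternating f" "alternating g"
  shows "energy K i (P f) (P g) = energy L i f g"
  unfolding energy_def coboundary_pullback using assms
  by (intro inner_pullback alternating_coboundary)

abbreviation "\<psi> \<equiv> inv_into (\<Union>K) \<phi>"

text \<open>Makes everything proved for \<phi> available for its inverse, whose pullback inverts
  \<open>P\<close>.\<close>

lemma inverse_embedding: "complex_embedding L \<psi>" "(`) \<psi> ` L = K"
proof -
  have "inj_on \<psi> (\<phi> ` \<Union>K)" by (rule inj_on_inv_into) simp
  moreover have "\<Union>L = \<phi> ` \<Union>K" by blast
  ultimately show "complex_embedding L \<psi>" by (simp add: complex_embedding_def simplicial_image)
  have "\<psi> ` \<phi> ` F = F" if "F \<in> K" for F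
    using inv_into_image_cancel[OF inj] that by blast
  then show "(`) \<psi> ` L = K" by (simp add: image_image)
qed

text \<open>The pullbacks along \<phi> and \<psi> are mutually inverse. On lists leaving the vertex
  set, the default value zero agrees with the vanishing of cochains there.\<close>

lemma bij_pullback: "bij_betw P (cochains L i) (cochains K i)"
proof (rule bij_betw_byWitness)
  interpret inv: complex_embedding L \<psi> by (rule inverse_embedding)
  show "P ` cochains L i \<subseteq> cochains K i" using pullback_cochain by blast
  show "inv.P ` cochains K i \<subseteq> cochains L i"
    using inv.pullback_cochain unfolding inverse_embedding(2) by blast
  have UL: "\<Union>L = \<phi> ` \<Union>K" by blast
  show "\<forall>f\<in>cochains L i. inv.P (P f) = f"
  proof (intro ballI ext)
    fix f xs assume f: "f \<in> cochains L i"
    show "inv.P (P f) xs = f xs"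
    proof (cases "set xs \<subseteq> \<Union>L")
      case True
      then have "map (\<phi> \<circ> \<psi>) xs = xs" unfolding UL
        by (intro map_idI) (metis comp_apply f_inv_into_f subsetD)
      moreover have "\<psi> ` set xs \<subseteq> \<Union>K" using True unfolding UL by (auto intro: inv_into_into)
      ultimately show ?thesis using True by (simp add: pullback_def)
    next
      case False
      then have "set xs \<notin> faces L i" by (auto simp: faces_def)
      with False f show ?thesis by (auto simp: pullback_def cochains_def)
    qed
  qed
  show "\<forall>g\<in>cochains K i. P (inv.P g) = g"
  proof (intro ballI ext)
    fix g xs assume g: "g \<in> cochains K i"
    show "P (inv.P g) xs = g xs"
    proof (cases "set xs \<subseteq> \<Union>K")
      case True
      then have "map (\<psi> \<circ> \<phi>) xs = xs"
        by (intro map_idI) (metis comp_apply inj inv_into_f_f subsetD)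
      moreover have "\<phi> ` set xs \<subseteq> \<Union>L" using True unfolding UL by blast
      ultimately show ?thesis using True by (simp add: pullback_def)
    next
      case False
      then have "set xs \<notin> faces K i" by (auto simp: faces_def)
      with False g show ?thesis by (auto simp: pullback_def cochains_def)
    qed
  qed
qed

text \<open>The test cochains on \<open>K\<close> are exactly the pullbacks of those on
  \<open>L\<close>, and pulling back preserves both forms of the weak eigenvalue equation.\<close>

lemma up_eigenspace_image: "up_eigenspace K i a = P ` up_eigenspace L i a"
proof -
  have bij: "P ` cochains L i = cochains K i" using bij_pullback by (rule bij_betw_imp_surj_on)
  have iff: "P f \<in> up_eigenspace K i a \<longleftrightarrow> f \<in> up_eigenspace L i a" if f: "f \<in> cochains L i" for f
    using f pullback_cochain[OF f] unfolding up_eigenspace_iff[OF K] up_eigenspace_iff[OF simplicial_image]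
      bij[symmetric] by (auto simp: energy_pullback inner_pullback cochains_iff)
  show ?thesis
  proof (intro equalityI subsetI)
    fix g assume g: "g \<in> up_eigenspace K i a"
    then obtain f where "f \<in> cochains L i" "g = P f" using up_eigenspace_subset bij by blast
    with g iff show "g \<in> P ` up_eigenspace L i a" by blast
  qed (use iff up_eigenspace_subset in blast)
qed

lemma dim_up_eigenspace_image:
  "real_fun.dim (up_eigenspace L i a) = real_fun.dim (up_eigenspace K i a)"
  unfolding up_eigenspace_image
  by (rule dim_linear_image[symmetric, OF linear_pullback subspace_up_eigenspace[OF simplicial_image]])
    (rule inj_on_subset[OF bij_betw_imp_inj_on[OF bij_pullback] up_eigenspace_subset])

end

section \<open>The wedge sum\<close>

text \<open>Injectivity of \<open>v\<close> and \<open>u\<close> puts each vertex into at most one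
  generating pair, so two consecutive steps of a chain lead back to the start and classes have at
  most two elements.\<close>

lemma wedge_class_eqD:
  fixes v :: "nat \<Rightarrow> 'a" and u :: "nat \<Rightarrow> 'b"
  assumes "wedge_class k v u p = wedge_class k v u q" "inj_on v {..k}" "inj_on u {..k}"
  shows "p = q \<or> (\<exists>j\<le>k. {p, q} = {Inl (v j), Inr (u j)})"
proof -
  define r where "r = {(Inl (v j) :: 'a + 'b, Inr (u j) :: 'a + 'b) | j. j \<le> k}"
  \<comment> \<open>Membership of \<open>q\<close> in its own class turns the equality of classes
    into a chain from \<open>p\<close> to \<open>q\<close>.\<close>
  have "q \<in> wedge_class k v u q" by (simp add: wedge_class_def Let_def)
  then have "q \<in> wedge_class k v u p" by (simp add: assms(1))
  then have "(p, q) \<in> (r \<union> r\<inverse>)\<^sup>*" by (simp add: wedge_class_def r_def Let_def)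
  then show ?thesis
  proof (induction rule: rtrancl_induct)
    case (step y z)
    from step.hyps(2) obtain j where j: "j \<le> k" "{y, z} = {Inl (v j), Inr (u j)}"
      by (auto simp: r_def)
    from step.IH show ?case
    proof
      assume "\<exists>j\<le>k. {p, y} = {Inl (v j), Inr (u j)}"
      then obtain l where l: "l \<le> k" "{p, y} = {Inl (v l), Inr (u l)}" by blast
      \<comment> \<open>Both pairs contain \<open>y\<close>, as a value of \<open>v\<close> in both
        or of \<open>u\<close> in both, so injectivity forces the same index and the second step
        undoes the first.\<close>
      have "l = j" using j l assms(2,3) by (auto simp: doubleton_eq_iff inj_on_def)
      then have "p = z" using j l by (auto simp: doubleton_eq_iff)
      then show ?thesis ..
    qed (use j in blast)
  qed simp
qed

theorem theorem6p1:
  fixes K\<^sub>1 :: "'a set set" and K\<^sub>2 :: "'b set set"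
    and v :: "nat \<Rightarrow> 'a" and u :: "nat \<Rightarrow> 'b" and i k :: nat
  assumes "simplicial_complex K\<^sub>1" and "simplicial_complex K\<^sub>2"
    and "inj_on v {..k}" and "v ` {..k} \<in> faces K\<^sub>1 k"
    and "inj_on u {..k}" and "u ` {..k} \<in> faces K\<^sub>2 k"
    and "k < i"
  shows "\<forall>a. a \<noteq> 0 \<longrightarrow>
    count (up_spectrum (wedge_sum k v u K\<^sub>1 K\<^sub>2) i) a =
    count (up_spectrum K\<^sub>1 i + up_spectrum K\<^sub>2 i) a"
proof -
  let ?c = "wedge_class k v u"
  let ?\<phi> = "\<lambda>x. ?c (Inl x)" and ?\<psi> = "\<lambda>x. ?c (Inr x)"
  note classD = wedge_class_eqD[OF _ assms(3,5)]
  \<comment> \<open>Two vertices of the same summand never form a pair of one \<open>Inl\<close> and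
    one \<open>Inr\<close>.\<close>
  have "inj ?\<phi>" "inj ?\<psi>"
    by (rule injI, drule classD, auto simp: doubleton_eq_iff)+
  then interpret emb\<^sub>1: complex_embedding K\<^sub>1 ?\<phi> + emb\<^sub>2: complex_embedding K\<^sub>2 ?\<psi>
    using assms(1,2) by unfold_locales (auto intro: inj_on_subset)
  interpret high_disjoint_union emb\<^sub>1.L emb\<^sub>2.L i
  proof
    fix F assume "F \<in> emb\<^sub>1.L" "F \<in> emb\<^sub>2.L"
    then obtain F\<^sub>1 F\<^sub>2 where F: "F = ?\<phi> ` F\<^sub>1" "F = ?\<psi> ` F\<^sub>2" by blast
    \<comment> \<open>Every vertex of a common face is identified with one from the other summand,
      which happens only along the glued face.\<close>
    have "F\<^sub>1 \<subseteq> v ` {..k}"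
    proof
      fix x assume "x \<in> F\<^sub>1"
      with F obtain y where "?c (Inl x) = ?c (Inr y)" by blast
      then show "x \<in> v ` {..k}" by (auto simp: doubleton_eq_iff dest: classD)
    qed
    then have "F \<subseteq> ?\<phi> ` v ` {..k}" unfolding F(1) by (rule image_mono)
    then have "card F \<le> card (?\<phi> ` v ` {..k})" by (intro card_mono) auto
    also have "\<dots> \<le> card {..k}" by (simp only: image_image card_image_le finite_atMost)
    finally have "card F \<le> card {..k}" .
    \<comment> \<open>The glued face has \<open>k + 1\<close> vertices, and \<open>k < i\<close>
      means \<open>k + 1 \<le> i\<close>.\<close>
    then show "card F \<le> i" using assms(7) by simp
  qed (fact emb\<^sub>1.simplicial_image emb\<^sub>2.simplicial_image)+
  have "wedge_sum k v u K\<^sub>1 K\<^sub>2 = emb\<^sub>1.L \<union> emb\<^sub>2.L"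
    by (simp add: wedge_sum_def image_image)
  \<comment> \<open>Multiplicities are dimensions of eigenspaces: they add over the union of the two
    images, and each image has the dimensions of its original complex.\<close>
  then show ?thesis
    using assms(1,2) complex_Un
    by (simp add: count_up_spectrum dim_up_eigenspace_Un emb\<^sub>1.dim_up_eigenspace_image
        emb\<^sub>2.dim_up_eigenspace_image)
qed

end
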